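(* For all integers $m\ge 1$ and $n\ge 3$, $\chi_{lat}(A(mW_n,v))=3$ if $n$ is even, and $\chi_{lat}(A(mW_n,v))=4$ if $n$ is odd.
   Context: Graphs are finite and simple. $W_n=C_n\vee K_1$ is the wheel of order $n+1\ge 4$, i.e. a cycle $C_n$ together with a central vertex $v$ adjacent to all cycle vertices. $A(mW_n,v)$ is the amalgamation of $m\ge 1$ copies of $W_n$ at $v$: the graph obtained from $m$ disjoint copies of $W_n$ by identifying their central vertices into a single vertex $v$ (so $A(W_n,v)=W_n$). For a graph $G$ of order $p$ and size $q$, a local antimagic total labeling of $G$ is a bijection $f:V(G)\cup E(G)\to\{1,\ldots,p+q\}$ such that $w_f(x)\neq w_f(y)$ for every edge $xy$ of $G$, where $w_f(x)=f(x)+\sum_{xz\in E(G)}f(xz)$. $\chi_{lat}(G)$ is the minimum number of distinct values of $w_f$ over all local antimagic total labelings $f$ of $G$. *)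

theory Defs
  imports "HOL-Library.Extended_Nat"
begin

record 'a ugraph =
  verts :: "'a set"
  edges :: "'a set set"

definition simple_graph :: "'a ugraph \<Rightarrow> bool" where
  "simple_graph G \<longleftrightarrow> finite (verts G) \<and> (\<forall>e \<in> edges G. e \<subseteq> verts G \<and> card e = 2)"

text \<open>For \<open>n \<ge> 3\<close> this is the cycle on the vertices \<open>0, \<dots>, n - 1\<close>; for smaller \<open>n\<close>
  it is not intended to be used.\<close>

definition cycle_graph :: "nat \<Rightarrow> nat ugraph" where
  "cycle_graph n = \<lparr>verts = {..<n}, edges = {{i, (i + 1) mod n} | i. i < n}\<rparr>"

definition complete_graph :: "'a set \<Rightarrow> 'a ugraph" where
  "complete_graph S = \<lparr>verts = S, edges = {{x, y} | x y. x \<in> S \<and> y \<in> S \<and> x \<noteq> y}\<rparr>"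

definition join :: "'a ugraph \<Rightarrow> 'b ugraph \<Rightarrow> ('a + 'b) ugraph" where
  "join G H =
    \<lparr>verts = verts G <+> verts H,
     edges = (image Inl) ` edges G \<union> (image Inr) ` edges H
       \<union> {{Inl x, Inr y} | x y. x \<in> verts G \<and> y \<in> verts H}\<rparr>"

definition wheel :: "nat \<Rightarrow> (nat + unit) ugraph" where
  "wheel n = join (cycle_graph n) (complete_graph {()})"

definition hub :: "nat + unit" where
  "hub = Inr ()"

text \<open>The \<open>m\<close> disjoint copies of \<open>G\<close> are indexed by \<open>0, \<dots>, m - 1\<close>. The vertex \<open>x\<close> of
  copy \<open>i\<close> is sent to \<open>Some (i, x)\<close>, except that all the copies of \<open>v\<close> are identified
  in the single vertex \<open>None\<close>.\<close>

definition amalg_vertex :: "'a \<Rightarrow> nat \<Rightarrow> 'a \<Rightarrow> (nat \<times> 'a) option" where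
  "amalg_vertex v i x = (if x = v then None else Some (i, x))"

definition amalgamation :: "nat \<Rightarrow> 'a ugraph \<Rightarrow> 'a \<Rightarrow> (nat \<times> 'a) option ugraph" where
  "amalgamation m G v =
    \<lparr>verts = (\<Union>i<m. amalg_vertex v i ` verts G),
     edges = (\<Union>i<m. (image (amalg_vertex v i)) ` edges G)\<rparr>"

text \<open>A total labeling assigns labels to the disjoint union of vertices (\<open>Inl\<close>) and
  edges (\<open>Inr\<close>).\<close>

definition weight :: "'a ugraph \<Rightarrow> ('a + 'a set \<Rightarrow> nat) \<Rightarrow> 'a \<Rightarrow> nat" where
  "weight G f x = f (Inl x) + (\<Sum>z | z \<in> verts G \<and> {x, z} \<in> edges G. f (Inr {x, z}))"

definition local_antimagic_total :: "'a ugraph \<Rightarrow> ('a + 'a set \<Rightarrow> nat) \<Rightarrow> bool" where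
  "local_antimagic_total G f \<longleftrightarrow>
    bij_betw f (verts G <+> edges G) {1..card (verts G) + card (edges G)} \<and>
    (\<forall>x y. {x, y} \<in> edges G \<longrightarrow> weight G f x \<noteq> weight G f y)"

text \<open>The infimum is a minimum whenever a local antimagic total labeling exists, and it is
  \<open>\<infinity>\<close> otherwise; so a finite value of \<open>chi_lat\<close> is always attained.\<close>

definition chi_lat :: "'a ugraph \<Rightarrow> enat" where
  "chi_lat G = (INF f \<in> {f. local_antimagic_total G f}. enat (card (weight G f ` verts G)))"

lemma simple_graph_cycle: "n \<ge> 3 \<Longrightarrow> simple_graph (cycle_graph n)"
proof -
  assume n: "n \<ge> 3"
  have "i \<noteq> (i + 1) mod n" if "i < n" for i
    using that n by (cases "i + 1 = n") auto
  then show ?thesis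
    using n by (auto simp: simple_graph_def cycle_graph_def card_insert_if)
qed

lemma simple_graph_complete: "finite S \<Longrightarrow> simple_graph (complete_graph S)"
  by (auto simp: simple_graph_def complete_graph_def)

lemma simple_graph_join:
  "simple_graph G \<Longrightarrow> simple_graph H \<Longrightarrow> simple_graph (join G H)"
  by (fastforce simp: simple_graph_def join_def card_image)

lemma simple_graph_amalgamation:
  assumes "simple_graph G"
  shows "simple_graph (amalgamation m G v)"
proof -
  have "inj (amalg_vertex v i)" for i
    by (auto simp: inj_on_def amalg_vertex_def split: if_splits)
  then have "card (amalg_vertex v i ` e) = card e" for i e
    by (meson card_image inj_on_subset subset_UNIV)
  then show ?thesis
    using assms by (fastforce simp: simple_graph_def amalgamation_def)
qed

lemma simple_graph_amalgamation_wheel: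
  "n \<ge> 3 \<Longrightarrow> simple_graph (amalgamation m (wheel n) hub)"
  unfolding wheel_def
  by (intro simple_graph_amalgamation simple_graph_join simple_graph_cycle
      simple_graph_complete) auto

end

theory Submission
  imports Defs
begin

text \<open>
  Lower bound. The weights are a proper colouring. The hub is adjacent to every other vertex, so
  its weight is not the weight of a rim vertex; and a cycle needs two colours, or three if its
  length is odd (\<open>card_cycle_colouring_ge\<close>, \<open>card_odd_cycle_colouring_ge\<close>).

  Upper bound. A rim vertex has as its weight the sum of its own label, the label of its spoke and
  the labels of its two rim edges. Write \<open>a\<^sub>0, b\<^sub>0, a\<^sub>1, b\<^sub>1, \<dots>\<close> for the consecutive rim edge
  labels of one copy of the wheel. The labels \<open>a\<^sub>t\<close> of all the copies fill one interval, and
  \<open>b\<^sub>t = C - a\<^sub>t\<close> for a constant \<open>C\<close>. A vertex between \<open>a\<^sub>t\<close> and \<open>b\<^sub>t\<close> then only needs its own label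
  and its spoke label to have a constant sum. A vertex between \<open>b\<^sub>t\<close> and \<open>a\<^sub>t\<^sub>+\<^sub>1\<close> has
  \<open>b\<^sub>t + a\<^sub>t\<^sub>+\<^sub>1 = C - a\<^sub>t + a\<^sub>t\<^sub>+\<^sub>1\<close>, which is compensated by the vertex label \<open>c + a\<^sub>t\<close> and the spoke
  label \<open>d - a\<^sub>t\<^sub>+\<^sub>1\<close>: a translate and a reflection of the numbers \<open>a\<^sub>t\<close>, hence again intervals. In
  an even cycle this covers all the rim vertices. In an odd cycle one vertex remains, lying between the
  last \<open>a\<^sub>k\<close> and \<open>a\<^sub>0\<close>. It gets the vertex label \<open>C - a\<^sub>k\<close> and the spoke label \<open>d - a\<^sub>0\<close>; these are
  exactly the numbers that the reflections \<open>C - a\<^sub>t\<close> and \<open>d - a\<^sub>t\<close> leave open in their intervals. The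
  intervals are arranged so that the resulting rim weights differ, and so that, next to the
  hub, the spokes have the largest labels, which makes the weight of the hub exceed all the others.\<close>

section \<open>Proper colourings of cycles\<close>

lemma card_cycle_colouring_ge:
  assumes "n \<ge> 2" and "\<And>j. j < n \<Longrightarrow> c j \<noteq> c (Suc j mod n)"
  shows "card (c ` {..<n}) \<ge> 2"
proof -
  have "c 0 \<noteq> c 1"
    using assms(2)[of 0] assms(1) by simp
  then have "2 = card {c 0, c 1}"
    by simp
  also have "\<dots> \<le> card (c ` {..<n})"
    using assms(1) by (intro card_mono) auto
  finally show ?thesis .
qed

lemma card_odd_cycle_colouring_ge:
  assumes "n \<ge> 3" and "odd n" and proper: "\<And>j. j < n \<Longrightarrow> c j \<noteq> c (Suc j mod n)"
  shows "card (c ` {..<n}) \<ge> 3"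
proof (rule ccontr)
  assume "\<not> card (c ` {..<n}) \<ge> 3"
  moreover have "c 0 \<noteq> c 1"
    using proper[of 0] assms(1) by simp
  then have "card {c 0, c 1} = 2"
    by simp
  moreover have "{c 0, c 1} \<subseteq> c ` {..<n}"
    using assms(1) by auto
  ultimately have two: "c ` {..<n} = {c 0, c 1}"
    by (metis card_seteq finite_imageI finite_lessThan not_less_eq_eq numeral_2_eq_2 numeral_3_eq_3)
  have "c j = (if even j then c 0 else c 1)" if "j < n" for j
    using that
  proof (induction j)
    case (Suc j)
    then have "c (Suc j) \<noteq> c j" "c (Suc j) \<in> {c 0, c 1}"
      using proper[of j] two by auto
    then show ?case
      using Suc by (auto split: if_splits)
  qed simp
  from this[of "n - 1"] have "c (n - 1) = c 0"
    using assms(1,2) by simp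
  then show False
    using proper[of "n - 1"] assms(1) by simp
qed

section \<open>The amalgamation of wheels at their hubs\<close>

abbreviation wheels :: "nat \<Rightarrow> nat \<Rightarrow> (nat \<times> (nat + unit)) option ugraph" where
  "wheels m n \<equiv> amalgamation m (wheel n) hub"

abbreviation rim :: "nat \<Rightarrow> nat \<Rightarrow> (nat \<times> (nat + unit)) option" where
  "rim i j \<equiv> Some (i, Inl j)"

definition cyclic_pred :: "nat \<Rightarrow> nat \<Rightarrow> nat" where
  "cyclic_pred n j = (if j = 0 then n - 1 else j - 1)"

lemma cyclic_pred_less: "j < n \<Longrightarrow> cyclic_pred n j < n"
  by (auto simp: cyclic_pred_def)

lemma Suc_mod_eq_iff_cyclic_pred:
  "i < n \<Longrightarrow> j < n \<Longrightarrow> Suc i mod n = j \<longleftrightarrow> i = cyclic_pred n j"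
  by (cases "Suc i = n") (auto simp: cyclic_pred_def)

lemma verts_wheels:
  assumes "m \<ge> 1"
  shows "verts (wheels m n) = insert None ((\<lambda>(i, j). rim i j) ` ({..<m} \<times> {..<n}))"
proof -
  have "verts (wheel n) = Inl ` {..<n} \<union> {hub}"
    by (auto simp: wheel_def join_def cycle_graph_def complete_graph_def hub_def)
  then have "amalg_vertex hub i ` verts (wheel n) = insert None (rim i ` {..<n})" for i
    by (auto simp: amalg_vertex_def hub_def image_Un image_image)
  moreover have "0 < m"
    using assms by simp
  ultimately show ?thesis
    by (auto simp: amalgamation_def)
qed

lemma edges_wheels:
  "edges (wheels m n) =
    (\<lambda>(i, j). {rim i j, rim i (Suc j mod n)}) ` ({..<m} \<times> {..<n}) \<union>
    (\<lambda>(i, j). {None, rim i j}) ` ({..<m} \<times> {..<n})"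
proof -
  have wheel: "edges (wheel n) =
      (\<lambda>j. {Inl j, Inl (Suc j mod n)}) ` {..<n} \<union> (\<lambda>j. {Inl j, hub}) ` {..<n}"
  proof -
    have "edges (cycle_graph n) = (\<lambda>j. {j, Suc j mod n}) ` {..<n}"
      by (auto simp: cycle_graph_def)
    moreover have "edges (complete_graph {()}) = {}"
      by (auto simp: complete_graph_def)
    moreover have "{{Inl x, Inr y} | x y. x \<in> verts (cycle_graph n) \<and> y \<in> verts (complete_graph {()})} =
        (\<lambda>j. {Inl j, hub}) ` {..<n}"
      by (auto simp: cycle_graph_def complete_graph_def hub_def)
    ultimately show ?thesis
      by (simp add: wheel_def join_def image_image)
  qed
  have "image (amalg_vertex hub i) ` edges (wheel n) =
      (\<lambda>j. {rim i j, rim i (Suc j mod n)}) ` {..<n} \<union> (\<lambda>j. {None, rim i j}) ` {..<n}" for i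
    unfolding wheel image_Un image_image
    by (simp add: amalg_vertex_def hub_def insert_commute)
  then show ?thesis
    unfolding amalgamation_def by auto
qed

lemma hub_adjacent_iff:
  "{None, x} \<in> edges (wheels m n) \<longleftrightarrow> (\<exists>i<m. \<exists>j<n. x = rim i j)"
  by (auto simp: edges_wheels doubleton_eq_iff)

lemma rim_adjacent_iff:
  assumes "i < m" and "j < n"
  shows "{rim i j, x} \<in> edges (wheels m n) \<longleftrightarrow>
    x = None \<or> x = rim i (Suc j mod n) \<or> x = rim i (cyclic_pred n j)"
proof -
  have "{rim i j, x} \<in> edges (wheels m n) \<longleftrightarrow>
      x = None \<or> x = rim i (Suc j mod n) \<or> (\<exists>l<n. Suc l mod n = j \<and> x = rim i l)"
    using assms by (auto simp: edges_wheels doubleton_eq_iff)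
  also have "(\<exists>l<n. Suc l mod n = j \<and> x = rim i l) \<longleftrightarrow> x = rim i (cyclic_pred n j)"
    using assms cyclic_pred_less Suc_mod_eq_iff_cyclic_pred by blast
  finally show ?thesis .
qed

lemma weight_hub:
  assumes "m \<ge> 1"
  shows "weight (wheels m n) f None =
    f (Inl None) + (\<Sum>(i, j)\<in>{..<m} \<times> {..<n}. f (Inr {None, rim i j}))"
proof -
  have "{z. z \<in> verts (wheels m n) \<and> {None, z} \<in> edges (wheels m n)} =
      (\<lambda>(i, j). rim i j) ` ({..<m} \<times> {..<n})"
    using assms by (auto simp: verts_wheels hub_adjacent_iff)
  moreover have "inj_on (\<lambda>(i, j). rim i j) ({..<m} \<times> {..<n})"
    by (auto simp: inj_on_def)
  ultimately show ?thesis
    by (simp add: weight_def sum.reindex case_prod_unfold)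
qed

lemma weight_rim:
  assumes "m \<ge> 1" and "n \<ge> 3" and "i < m" and "j < n"
  shows "weight (wheels m n) f (rim i j) =
    f (Inl (rim i j)) + f (Inr {None, rim i j}) + f (Inr {rim i j, rim i (Suc j mod n)}) +
    f (Inr {rim i (cyclic_pred n j), rim i j})"
proof -
  have "Suc j mod n < n" "cyclic_pred n j < n"
    using assms by (simp_all add: cyclic_pred_less)
  then have "{z. z \<in> verts (wheels m n) \<and> {rim i j, z} \<in> edges (wheels m n)} =
      {None, rim i (Suc j mod n), rim i (cyclic_pred n j)}"
    using assms by (auto simp: verts_wheels rim_adjacent_iff)
  moreover have "Suc j mod n \<noteq> cyclic_pred n j"
    using assms by (cases "Suc j = n") (auto simp: cyclic_pred_def)
  ultimately show ?thesis
    by (simp add: weight_def insert_commute)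
qed

section \<open>Lower bound\<close>

lemma card_weights_wheels_ge:
  assumes "m \<ge> 1" and "n \<ge> 3" and f: "local_antimagic_total (wheels m n) f"
  shows "card (weight (wheels m n) f ` verts (wheels m n)) \<ge> (if even n then 3 else 4)"
proof -
  let ?w = "weight (wheels m n) f"
  define c where "c j = ?w (rim 0 j)" for j
  have adjacent: "?w x \<noteq> ?w y" if "{x, y} \<in> edges (wheels m n)" for x y
    using f that by (auto simp: local_antimagic_total_def)
  have "c j \<noteq> c (Suc j mod n)" if "j < n" for j
    unfolding c_def using that assms by (intro adjacent) (simp add: rim_adjacent_iff)
  then have "card (c ` {..<n}) \<ge> (if even n then 2 else 3)"
    using card_cycle_colouring_ge[of n c] card_odd_cycle_colouring_ge[of n c] assms by simp
  moreover have "?w None \<noteq> c j" if "j < n" for j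
    unfolding c_def using that assms by (intro adjacent) (auto simp: hub_adjacent_iff)
  then have "?w None \<notin> c ` {..<n}"
    by auto
  moreover have "insert None (rim 0 ` {..<n}) \<subseteq> verts (wheels m n)"
    using assms by (auto simp: verts_wheels)
  then have "?w ` insert None (rim 0 ` {..<n}) \<subseteq> ?w ` verts (wheels m n)"
    by (rule image_mono)
  then have "card (insert (?w None) (c ` {..<n})) \<le> card (?w ` verts (wheels m n))"
    using assms by (intro card_mono) (simp_all add: verts_wheels c_def image_image)
  ultimately show ?thesis
    by (auto split: if_splits)
qed

section \<open>Enumerating vertices and edges\<close>

text \<open>Labels are defined on an index type, with the edge that leaves rim vertex \<open>j\<close> towards its
  successor indexed by \<open>j\<close>, so that they need not be defined on unordered pairs.\<close>

datatype site = Hub | Rim nat nat | Spoke nat nat | Rim_Edge nat nat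

definition sites :: "nat \<Rightarrow> nat \<Rightarrow> site set" where
  "sites m n = insert Hub (case_prod Rim ` ({..<m} \<times> {..<n}) \<union>
     case_prod Spoke ` ({..<m} \<times> {..<n}) \<union> case_prod Rim_Edge ` ({..<m} \<times> {..<n}))"

fun site_element :: "nat \<Rightarrow> site \<Rightarrow>
    (nat \<times> (nat + unit)) option + (nat \<times> (nat + unit)) option set" where
  "site_element n Hub = Inl None"
| "site_element n (Rim i j) = Inl (rim i j)"
| "site_element n (Spoke i j) = Inr {None, rim i j}"
| "site_element n (Rim_Edge i j) = Inr {rim i j, rim i (Suc j mod n)}"

lemma finite_sites: "finite (sites m n)"
  by (simp add: sites_def)

lemma card_sites: "card (sites m n) = 3 * (m * n) + 1"
proof -
  let ?P = "{..<m} \<times> {..<n}"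
  let ?R = "case_prod Rim ` ?P" and ?S = "case_prod Spoke ` ?P" and ?E = "case_prod Rim_Edge ` ?P"
  have "card ?R = m * n" "card ?S = m * n" "card ?E = m * n"
    by (subst card_image; auto simp: inj_on_def)+
  moreover have "Hub \<notin> ?R \<union> ?S \<union> ?E" "?R \<inter> ?S = {}" "(?R \<union> ?S) \<inter> ?E = {}"
    by auto
  ultimately show ?thesis
    unfolding sites_def by (simp add: card_Un_disjoint del: Un_iff)
qed

text \<open>Rim edges are enumerated without repetition because the cycle has length at least 3.\<close>

lemma bij_betw_site_element:
  assumes "m \<ge> 1" and "n \<ge> 3"
  shows "bij_betw (site_element n) (sites m n) (verts (wheels m n) <+> edges (wheels m n))"
proof -
  have no_digon: "Suc (Suc j mod n) mod n \<noteq> j" if "j < n" for j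
    using that assms by (cases "Suc j = n"; cases "Suc (Suc j) = n") auto
  have "inj_on (site_element n) (sites m n)"
    unfolding sites_def inj_on_def
    using no_digon by (auto simp: doubleton_eq_iff)
  moreover have "site_element n ` sites m n = verts (wheels m n) <+> edges (wheels m n)"
    using assms(1)
    by (simp add: sites_def verts_wheels edges_wheels Plus_def image_Un image_image
        case_prod_unfold Un_ac)
  ultimately show ?thesis
    by (simp add: bij_betw_def)
qed

lemma card_verts_edges_wheels:
  assumes "m \<ge> 1" and "n \<ge> 3"
  shows "card (verts (wheels m n)) + card (edges (wheels m n)) = 3 * (m * n) + 1"
proof -
  have "card (verts (wheels m n) <+> edges (wheels m n)) = 3 * (m * n) + 1"
    using bij_betw_same_card[OF bij_betw_site_element[OF assms]] card_sites by simp
  moreover have "finite (verts (wheels m n))" "finite (edges (wheels m n))"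
    using assms(1) by (simp_all add: verts_wheels edges_wheels)
  ultimately show ?thesis
    by (simp add: card_Plus)
qed

section \<open>The labeling\<close>

text \<open>The position of rim index \<open>j\<close> of copy \<open>i\<close> among all the rim indices of the same parity,
  ordered by \<open>j\<close> and then by \<open>i\<close>. In an odd cycle the last even index thus comes after all
  the others, in all the copies, and the others form an interval.\<close>

definition rank :: "nat \<Rightarrow> nat \<Rightarrow> nat \<Rightarrow> nat" where
  "rank m i j = (j div 2) * m + i"

text \<open>\<open>M\<close> and \<open>K\<close> count the even and the odd rim indices of all the copies. From bottom to
  top, the labels are divided into intervals of the lengths \<open>M, M, K, K, M, K, 1\<close>: even rim
  edges; odd rim edges (and, in an odd cycle, rim vertex 0); the other even rim vertices; odd rim
  vertices; even spokes; odd spokes; hub. The label of an even rim vertex is a translate of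
  the label \<open>a\<^sub>t\<close> that precedes it at distance two, which has the same rank as the rim edge just
  before the vertex; but if that edge is itself even, at vertex 0 of an odd cycle, it is a
  reflection of its label.\<close>

fun label :: "nat \<Rightarrow> nat \<Rightarrow> site \<Rightarrow> nat" where
  "label m n Hub = 3 * (m * n) + 1"
| "label m n (Rim_Edge i j) = (let M = (n - n div 2) * m in
     if even j then rank m i j + 1 else 2 * M - rank m i j)"
| "label m n (Spoke i j) = (let M = (n - n div 2) * m; K = (n div 2) * m in
     if even j then 3 * M + 2 * K - rank m i j else 3 * M + 3 * K - rank m i j)"
| "label m n (Rim i j) = (let M = (n - n div 2) * m; K = (n div 2) * m; p = cyclic_pred n j in
     if odd j then 2 * M + K + rank m i j + 1
     else if odd p then 2 * M + rank m i p + 1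
     else 2 * M - rank m i p)"

lemma half_counts: "(n - n div 2) * m + (n div 2) * m = m * (n :: nat)"
proof -
  have "(n - n div 2) * m + (n div 2) * m = ((n - n div 2) + n div 2) * m"
    by (simp only: add_mult_distrib)
  then show ?thesis
    by simp
qed

lemma rank_less:
  assumes "i < m" and "j div 2 < a"
  shows "rank m i j < a * m"
proof -
  have "rank m i j < Suc (j div 2) * m"
    using assms(1) by (simp add: rank_def)
  also have "\<dots> \<le> a * m"
    using assms(2) by (intro mult_le_mono1) simp
  finally show ?thesis .
qed

lemma rank_less_even:
  assumes "i < m" and "j < n"
  shows "rank m i j < (n - n div 2) * m"
  using assms by (intro rank_less) auto

lemma rank_less_odd:
  assumes "i < m" and "j < n" and "odd j"
  shows "rank m i j < (n div 2) * m"
  using assms by (intro rank_less) (auto elim!: oddE)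

lemma rank_surj:
  assumes "r < a * m"
  obtains t i where "t < a" and "i < m" and "rank m i (2 * t) = r" and "rank m i (2 * t + 1) = r"
proof
  show "r div m < a"
    using assms by (simp add: less_mult_imp_div_less)
  show "r mod m < m"
    using assms by (cases "m = 0") auto
  show "rank m (r mod m) (2 * (r div m)) = r" "rank m (r mod m) (2 * (r div m) + 1) = r"
    by (simp_all add: rank_def)
qed

lemma label_surj:
  assumes "m \<ge> 1" and "n \<ge> 3" and "x \<in> {1..3 * (m * n) + 1}"
  shows "x \<in> label m n ` sites m n"
proof -
  define M where "M = (n - n div 2) * m"
  define K where "K = (n div 2) * m"
  have MK: "M + K = m * n"
    unfolding M_def K_def by (rule half_counts)
  have in_sites: "Hub \<in> sites m n"
      "\<And>i j. i < m \<Longrightarrow> j < n \<Longrightarrow> Rim i j \<in> sites m n"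
      "\<And>i j. i < m \<Longrightarrow> j < n \<Longrightarrow> Spoke i j \<in> sites m n"
      "\<And>i j. i < m \<Longrightarrow> j < n \<Longrightarrow> Rim_Edge i j \<in> sites m n"
    by (auto simp: sites_def)
  have even_site: "\<exists>i<m. \<exists>j<n. even j \<and> rank m i j = r" if "r < M" for r
  proof -
    obtain t i where "t < n - n div 2" "i < m" "rank m i (2 * t) = r"
      using \<open>r < M\<close> unfolding M_def by (rule rank_surj)
    moreover from this have "2 * t < n"
      by linarith
    ultimately show ?thesis
      by (metis dvd_triv_left)
  qed
  have odd_site: "\<exists>i<m. \<exists>j<n. odd j \<and> rank m i j = r" if "r < K" for r
  proof -
    obtain t i where "t < n div 2" "i < m" "rank m i (2 * t + 1) = r"
      using \<open>r < K\<close> unfolding K_def by (rule rank_surj)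
    moreover from this have "2 * t + 1 < n"
      by linarith
    ultimately show ?thesis
      by (metis even_mult_iff even_plus_one_iff dvd_refl)
  qed
  consider "x \<le> M" | "M < x" "x \<le> 2 * M - K" | "2 * M - K < x" "M < x" "x \<le> 2 * M"
    | "2 * M < x" "x \<le> 2 * M + K" | "2 * M + K < x" "x \<le> 2 * M + 2 * K"
    | "2 * M + 2 * K < x" "x \<le> 3 * M + 2 * K" | "3 * M + 2 * K < x" "x \<le> 3 * M + 3 * K"
    | "x = 3 * M + 3 * K + 1"
    using assms(3) MK by force
  then show ?thesis
  proof cases
    case 1
    then have "x - 1 < M"
      using assms(3) by auto
    then obtain i j where "i < m" "j < n" "even j" "rank m i j = x - 1"
      using even_site by blast
    then have "x = label m n (Rim_Edge i j)"
      using assms(3) by simp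
    then show ?thesis
      using in_sites \<open>i < m\<close> \<open>j < n\<close> by blast
  next
    case 2
    \<comment> \<open>This case is only possible in an odd cycle; the label is that of a rim vertex 0.\<close>
    have "odd n"
    proof
      assume "even n"
      then have "M = K"
        by (auto simp: M_def K_def elim!: evenE)
      then show False
        using 2 by simp
    qed
    then obtain k where n: "n = 2 * k + 1"
      by (rule oddE)
    then have "M = K + m" "K = k * m"
      by (simp_all add: M_def K_def Suc_diff_le)
    define i where "i = 2 * M - x - K"
    have "i < m" "rank m i (n - 1) = 2 * M - x"
      using 2 \<open>M = K + m\<close> \<open>K = k * m\<close> by (auto simp: i_def rank_def n)
    moreover have "label m n (Rim i 0) = 2 * M - rank m i (n - 1)"
      using n by (simp add: cyclic_pred_def M_def)
    ultimately have "x = label m n (Rim i 0)"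
      using 2 by simp
    then show ?thesis
      using in_sites \<open>i < m\<close> \<open>n \<ge> 3\<close> by force
  next
    case 3
    then have "2 * M - x < K"
      by linarith
    then obtain i j where "i < m" "j < n" "odd j" "rank m i j = 2 * M - x"
      using odd_site by blast
    then have "x = label m n (Rim_Edge i j)"
      using 3 by (simp flip: M_def)
    then show ?thesis
      using in_sites \<open>i < m\<close> \<open>j < n\<close> by blast
  next
    case 4
    then have "x - 2 * M - 1 < K"
      by linarith
    then obtain i p where p: "i < m" "p < n" "odd p" "rank m i p = x - 2 * M - 1"
      using odd_site by blast
    \<comment> \<open>The labels of this interval follow the odd rim edges: the label belongs to the vertex
      at the end of edge \<open>p\<close>.\<close>
    define j where "j = Suc p mod n"
    have "j < n" "even j" "cyclic_pred n j = p"
      using p by (cases "Suc p = n"; auto simp: j_def cyclic_pred_def; fail)+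
    then have "x = label m n (Rim i j)"
      using 4 p by (simp flip: M_def)
    then show ?thesis
      using in_sites \<open>i < m\<close> \<open>j < n\<close> by blast
  next
    case 5
    then have "x - 2 * M - K - 1 < K"
      by linarith
    then obtain i j where "i < m" "j < n" "odd j" "rank m i j = x - 2 * M - K - 1"
      using odd_site by blast
    then have "x = label m n (Rim i j)"
      using 5 by (simp flip: M_def K_def)
    then show ?thesis
      using in_sites \<open>i < m\<close> \<open>j < n\<close> by blast
  next
    case 6
    then have "3 * M + 2 * K - x < M"
      by linarith
    then obtain i j where "i < m" "j < n" "even j" "rank m i j = 3 * M + 2 * K - x"
      using even_site by blast
    then have "x = label m n (Spoke i j)"
      using 6 by (simp flip: M_def K_def)
    then show ?thesis
      using in_sites \<open>i < m\<close> \<open>j < n\<close> by blast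
  next
    case 7
    then have "3 * M + 3 * K - x < K"
      by linarith
    then obtain i j where "i < m" "j < n" "odd j" "rank m i j = 3 * M + 3 * K - x"
      using odd_site by blast
    then have "x = label m n (Spoke i j)"
      using 7 by (simp flip: M_def K_def)
    then show ?thesis
      using in_sites \<open>i < m\<close> \<open>j < n\<close> by blast
  next
    case 8
    then have "x = label m n Hub"
      using MK by simp
    then show ?thesis
      using in_sites by blast
  qed
qed

text \<open>There are as many sites as labels, so surjectivity suffices.\<close>

lemma bij_betw_label:
  assumes "m \<ge> 1" and "n \<ge> 3"
  shows "bij_betw (label m n) (sites m n) {1..3 * (m * n) + 1}"
proof -
  have "{1..3 * (m * n) + 1} \<subseteq> label m n ` sites m n"
    using label_surj[OF assms] by blast
  moreover have "card (label m n ` sites m n) \<le> card {1..3 * (m * n) + 1}"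
    using card_image_le[OF finite_sites[of m n]] by (simp add: card_sites)
  ultimately have "label m n ` sites m n = {1..3 * (m * n) + 1}"
    using card_seteq finite_sites by (metis finite_imageI)
  moreover from this have "inj_on (label m n) (sites m n)"
    by (intro eq_card_imp_inj_on finite_sites) (simp add: card_sites)
  ultimately show ?thesis
    by (simp add: bij_betw_def)
qed

section \<open>The weights of the labeling\<close>

definition wheels_labeling where
  "wheels_labeling m n = label m n \<circ> the_inv_into (sites m n) (site_element n)"

lemma bij_betw_wheels_labeling:
  assumes "m \<ge> 1" and "n \<ge> 3"
  shows "bij_betw (wheels_labeling m n) (verts (wheels m n) <+> edges (wheels m n))
    {1..card (verts (wheels m n)) + card (edges (wheels m n))}"
  unfolding wheels_labeling_def card_verts_edges_wheels[OF assms]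
  by (rule bij_betw_trans[OF bij_betw_the_inv_into[OF bij_betw_site_element[OF assms]]
        bij_betw_label[OF assms]])

lemma wheels_labeling_site_element:
  assumes "m \<ge> 1" and "n \<ge> 3" and "s \<in> sites m n"
  shows "wheels_labeling m n (site_element n s) = label m n s"
  using assms bij_betw_site_element
  by (simp add: wheels_labeling_def the_inv_into_f_f bij_betw_def)

lemma wheels_labeling_simps:
  assumes "m \<ge> 1" and "n \<ge> 3"
  shows "wheels_labeling m n (Inl None) = label m n Hub"
    and "i < m \<Longrightarrow> j < n \<Longrightarrow> wheels_labeling m n (Inl (rim i j)) = label m n (Rim i j)"
    and "i < m \<Longrightarrow> j < n \<Longrightarrow> wheels_labeling m n (Inr {None, rim i j}) = label m n (Spoke i j)"
    and "i < m \<Longrightarrow> j < n \<Longrightarrow>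
      wheels_labeling m n (Inr {rim i j, rim i (Suc j mod n)}) = label m n (Rim_Edge i j)"
  using wheels_labeling_site_element[OF assms, of Hub]
    wheels_labeling_site_element[OF assms, of "Rim i j"]
    wheels_labeling_site_element[OF assms, of "Spoke i j"]
    wheels_labeling_site_element[OF assms, of "Rim_Edge i j"]
  by (auto simp: sites_def simp del: label.simps)

text \<open>The three cases are the vertices between \<open>a\<^sub>t\<close> and \<open>b\<^sub>t\<close>, between the last \<open>a\<^sub>k\<close> and \<open>a\<^sub>0\<close>, and
  between \<open>b\<^sub>t\<close> and the following even edge; in each of them the ranks cancel.\<close>

lemma weight_wheels_labeling_rim:
  fixes m n :: nat
  defines "M \<equiv> (n - n div 2) * m" and "K \<equiv> (n div 2) * m"
  assumes "m \<ge> 1" and "n \<ge> 3" and "i < m" and "j < n"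
  shows "weight (wheels m n) (wheels_labeling m n) (rim i j) =
    (if odd j then 7 * M + 4 * K + 2
     else if j = 0 \<and> odd n then 5 * M + 2 * K + 2
     else 7 * M + 2 * K + 2)"
proof -
  define p where "p = cyclic_pred n j"
  have p: "p < n" "Suc p mod n = j"
    using assms(6) cyclic_pred_less[of j n] Suc_mod_eq_iff_cyclic_pred[of p n j] by (auto simp: p_def)
  have weight: "weight (wheels m n) (wheels_labeling m n) (rim i j) =
      label m n (Rim i j) + label m n (Spoke i j) + label m n (Rim_Edge i j) +
      label m n (Rim_Edge i p)"
    using wheels_labeling_simps(4)[OF assms(3-5) p(1)] assms(3-6)
    by (simp add: weight_rim wheels_labeling_simps p(2) del: label.simps flip: p_def)
  have less: "rank m i j < M" "rank m i p < M"
    using assms(5,6) p(1) by (simp_all add: M_def rank_less_even)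
  show ?thesis
  proof (cases "odd j")
    case True
    then have "even p" "rank m i p = rank m i j"
      by (auto simp: p_def cyclic_pred_def rank_def elim!: oddE)
    then show ?thesis
      using True less unfolding weight
      by (simp flip: M_def K_def)
  next
    case False
    then have "odd p \<longleftrightarrow> \<not> (j = 0 \<and> odd n)"
      using assms(4) by (auto simp: p_def cyclic_pred_def)
    moreover have "label m n (Rim i j) =
        (if odd p then 2 * M + rank m i p + 1 else 2 * M - rank m i p)"
      using False by (simp flip: M_def p_def)
    ultimately show ?thesis
      using False less unfolding weight
      by (cases "odd p") (simp_all del: label.simps(4) flip: M_def K_def)
  qed
qed

text \<open>Each of the \<open>m * n \<ge> 3\<close> spokes has a label above \<open>2 * (m * n)\<close>. The bound is stated for
  comparison with the rim weights, which are at most \<open>7 * (m * n) + 2\<close>.\<close>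

lemma weight_wheels_labeling_hub_gt:
  assumes "m \<ge> 1" and "n \<ge> 3"
  shows "weight (wheels m n) (wheels_labeling m n) None > 7 * (m * n) + 2"
proof -
  let ?N = "m * n"
  have "?N \<ge> 1 * 3"
    using assms by (intro mult_le_mono)
  then have "7 * ?N \<le> (2 * ?N + 1) * ?N"
    by (intro mult_le_mono1) simp
  also have "\<dots> = (\<Sum>(i, j)\<in>{..<m} \<times> {..<n}. 2 * ?N + 1)"
    by (simp add: case_prod_unfold)
  also have "\<dots> \<le> (\<Sum>(i, j)\<in>{..<m} \<times> {..<n}. wheels_labeling m n (Inr {None, rim i j}))"
  proof (intro sum_mono)
    fix x
    assume "x \<in> {..<m} \<times> {..<n}"
    then obtain i j where x: "x = (i, j)" and ij: "i < m" "j < n"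
      by auto
    define M K where "M = (n - n div 2) * m" and "K = (n div 2) * m"
    have "?N = M + K" "rank m i j < M" "odd j \<Longrightarrow> rank m i j < K"
      using ij half_counts[of n m] rank_less_even[of i m j n] rank_less_odd[of i m j n]
      by (simp_all add: M_def K_def)
    then have "2 * ?N + 1 \<le> label m n (Spoke i j)"
      by (cases "even j") (simp_all flip: M_def K_def)
    then show "(case x of (i, j) \<Rightarrow> 2 * ?N + 1)
        \<le> (case x of (i, j) \<Rightarrow> wheels_labeling m n (Inr {None, rim i j}))"
      using ij assms by (simp add: x wheels_labeling_simps del: label.simps)
  qed
  finally show ?thesis
    using assms \<open>?N \<ge> 1 * 3\<close> by (simp add: weight_hub wheels_labeling_simps)
qed

lemma weight_wheels_labeling_rim_less_hub:
  assumes "m \<ge> 1" and "n \<ge> 3" and "i < m" and "j < n"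
  shows "weight (wheels m n) (wheels_labeling m n) (rim i j) <
    weight (wheels m n) (wheels_labeling m n) None"
proof -
  define M K where "M = (n - n div 2) * m" and "K = (n div 2) * m"
  have "m * n = M + K"
    using half_counts[of n m] by (simp add: M_def K_def)
  then have "weight (wheels m n) (wheels_labeling m n) (rim i j) \<le> 7 * (m * n) + 2"
    using assms by (simp add: weight_wheels_labeling_rim flip: M_def K_def)
  then show ?thesis
    using weight_wheels_labeling_hub_gt[OF assms(1,2)] by linarith
qed

lemma local_antimagic_total_wheels_labeling:
  assumes "m \<ge> 1" and "n \<ge> 3"
  shows "local_antimagic_total (wheels m n) (wheels_labeling m n)"
proof -
  let ?w = "weight (wheels m n) (wheels_labeling m n)"
  have "(n div 2) * m > 0" "(n - n div 2) * m > 0"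
    using assms by simp_all
  then have rim_edge: "?w (rim i j) \<noteq> ?w (rim i (Suc j mod n))" if "i < m" "j < n" for i j
    using that assms by (cases "Suc j = n") (auto simp: weight_wheels_labeling_rim)
  have spoke: "?w (rim i j) \<noteq> ?w None" if "i < m" "j < n" for i j
    using weight_wheels_labeling_rim_less_hub[OF assms that] by simp
  have "?w x \<noteq> ?w y" if "{x, y} \<in> edges (wheels m n)" for x y
  proof -
    from that obtain i j where "i < m" "j < n"
      "{x, y} = {rim i j, rim i (Suc j mod n)} \<or> {x, y} = {None, rim i j}"
      by (auto simp: edges_wheels)
    then show ?thesis
      using rim_edge[of i j] spoke[of i j] by (metis doubleton_eq_iff)
  qed
  then show ?thesis
    using bij_betw_wheels_labeling[OF assms] by (simp add: local_antimagic_total_def)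
qed

lemma card_weights_wheels_labeling_le:
  assumes "m \<ge> 1" and "n \<ge> 3"
  shows "card (weight (wheels m n) (wheels_labeling m n) ` verts (wheels m n))
    \<le> (if even n then 3 else 4)"
proof -
  let ?w = "weight (wheels m n) (wheels_labeling m n)"
  let ?M = "(n - n div 2) * m" and ?K = "(n div 2) * m"
  let ?A = "{?w None, 7 * ?M + 4 * ?K + 2, 7 * ?M + 2 * ?K + 2}"
  let ?B = "if even n then ?A else insert (5 * ?M + 2 * ?K + 2) ?A"
  have "?w ` verts (wheels m n) \<subseteq> ?B"
    using assms by (auto simp: verts_wheels weight_wheels_labeling_rim)
  then have "card (?w ` verts (wheels m n)) \<le> card ?B"
    by (intro card_mono) auto
  also have "card ?A \<le> 3"
    by (simp add: card_insert_if)
  then have "card ?B \<le> (if even n then 3 else 4)"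
    by (auto simp: card_insert_if)
  finally show ?thesis .
qed

theorem theorem3p9:
  fixes m n :: nat
  assumes "m \<ge> 1" and "n \<ge> 3"
  shows "(even n \<longrightarrow> chi_lat (amalgamation m (wheel n) hub) = 3) \<and>
         (odd n \<longrightarrow> chi_lat (amalgamation m (wheel n) hub) = 4)"
proof -
  let ?c = "if even n then 3 else 4 :: nat"
  have "chi_lat (wheels m n) = enat ?c"
  proof (rule antisym)
    have "chi_lat (wheels m n) \<le>
        enat (card (weight (wheels m n) (wheels_labeling m n) ` verts (wheels m n)))"
      unfolding chi_lat_def using local_antimagic_total_wheels_labeling[OF assms]
      by (intro INF_lower) simp
    also have "\<dots> \<le> enat ?c"
      using card_weights_wheels_labeling_le[OF assms] by (simp only: enat_ord_simps)
    finally show "chi_lat (wheels m n) \<le> enat ?c" .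
    show "enat ?c \<le> chi_lat (wheels m n)"
      unfolding chi_lat_def using card_weights_wheels_ge[OF assms]
      by (intro INF_greatest) (simp only: enat_ord_simps mem_Collect_eq)
  qed
  then show ?thesis
    by (simp add: numeral_eq_enat)
qed

end
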